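(* Let $n \ge 1$ be an integer and let $n' = \lceil \sqrt{n(n+1)/2}\, \rceil$. For any block $B_{x,y}$ of the $n' \times n'$ grid (with integers $0 \le x, y \le n'-1$) whose index $\lambda = x + y n'$ satisfies $\lambda \in [0, n(n+1)/2 - 1]$, the coordinates $(i,j)$ corresponding to $\lambda$ in the lower-triangular domain, i.e. the unique position (row $i$, column $j$, with $0 \le j \le i \le n-1$) at which the number $\lambda$ appears in the row-by-row indexing of the lower triangle, are given by $$g(\lambda) = (i,j) = \left( \left\lfloor \sqrt{\tfrac{1}{4} + 2\lambda} - \tfrac{1}{2} \right\rfloor,\ \lambda - \frac{i(i+1)}{2} \right),$$ where the $i$ in the second component is the first component.
   Context: The lower-triangular domain of size $n$ consists of the positions $(i,j)$ of an $n \times n$ array with row index $i$ and column index $j$ (both starting at $0$) satisfying $0 \le j \le i \le n-1$; it has $n(n+1)/2$ positions, the diagonal included. These positions are indexed by $0, 1, \dots, n(n+1)/2 - 1$ row by row from the top, and from left to right within each row: $$\begin{matrix} 0 & & & & \\ 1 & 2 & & & \\ 3 & 4 & 5 & & \\ \vdots & \vdots & \vdots & \ddots & \\ \frac{n(n-1)}{2} & \frac{n(n-1)}{2}+1 & \cdots & \cdots & \frac{n(n+1)}{2}-1 \end{matrix}$$ The grid is a square array of $n' \times n'$ blocks $B_{x,y}$, with $n' = \lceil \sqrt{n(n+1)/2}\,\rceil$, where $x,y \in \{0,\dots,n'-1\}$; the block $B_{x,y}$ has index $\lambda = x + y n'$. *)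

theory Defs
  imports Complex_Main
begin

(* All coordinates, sizes and indices are integers, so no subtraction truncates. The products
   n * (n + 1) and i * (i + 1) are even, so halving them with div is exact. *)

definition lower_tri :: "int \<Rightarrow> (int \<times> int) set" where
  "lower_tri n = {(i, j). 0 \<le> j \<and> j \<le> i \<and> i \<le> n - 1}"

definition read_before :: "int \<times> int \<Rightarrow> int \<times> int \<Rightarrow> bool" where
  "read_before p q \<longleftrightarrow> fst p < fst q \<or> (fst p = fst q \<and> snd p < snd q)"

(* The number written at p when the triangle is numbered 0, 1, 2, ... in reading order:
   the count of positions visited before p. *)
definition tri_index :: "int \<Rightarrow> int \<times> int \<Rightarrow> int" where
  "tri_index n p = int (card {q \<in> lower_tri n. read_before q p})"

(* Meaningful only if exactly one position carries the number l. *)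
definition tri_position :: "int \<Rightarrow> int \<Rightarrow> int \<times> int" where
  "tri_position n l = (THE p. p \<in> lower_tri n \<and> tri_index n p = l)"

definition grid_width :: "int \<Rightarrow> int" where
  "grid_width n = \<lceil>sqrt (of_int (n * (n + 1)) / 2)\<rceil>"

definition block_index :: "int \<Rightarrow> int \<Rightarrow> int \<Rightarrow> int" where
  "block_index n x y = x + y * grid_width n"

definition g :: "int \<Rightarrow> int \<times> int" where
  "g l = (let i = \<lfloor>sqrt (1 / 4 + 2 * of_int l) - 1 / 2\<rfloor> in (i, l - i * (i + 1) div 2))"

end

theory Submission
  imports Defs
begin

text \<open>
  Row \<open>i\<close> starts at the triangular number \<open>i (i + 1) / 2\<close>, and completing the square turns
  \<open>i (i + 1) / 2 \<le> l < (i + 1) (i + 2) / 2\<close> into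
  \<open>i \<le> sqrt (1 / 4 + 2 l) - 1 / 2 < i + 1\<close>. Hence \<^const>\<open>g\<close> is a left inverse of the
  numbering, which gives uniqueness; a position carrying a given number exists by adding one row
  at a time.
\<close>

text \<open>The sum \<open>i + 1 + 1\<close> stays unevaluated so that the equation rewrites
  induction goals at \<open>n + 1\<close> directly.\<close>

lemma triangular_Suc: "(i + 1) * (i + 1 + 1) div 2 = i * (i + 1) div 2 + (i + 1)" for i :: int
proof -
  have "(i + 1) * (i + 1 + 1) = i * (i + 1) + 2 * (i + 1)"
    by (simp add: algebra_simps)
  then show ?thesis
    by simp
qed

lemma lower_tri_Suc:
  assumes "n \<ge> 0"
  shows "lower_tri (n + 1) = lower_tri n \<union> {n} \<times> {0..n}"
  using assms by (auto simp: lower_tri_def)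

lemma finite_lower_tri: "finite (lower_tri n)"
  by (rule finite_subset[of _ "{0..n} \<times> {0..n}"]) (auto simp: lower_tri_def)

lemma card_lower_tri:
  assumes "n \<ge> 0"
  shows "int (card (lower_tri n)) = n * (n + 1) div 2"
  using assms
proof (induction n rule: int_ge_induct)
  case base
  have "lower_tri 0 = {}"
    by (auto simp: lower_tri_def)
  then show ?case
    by simp
next
  case (step n)
  have "lower_tri n \<inter> {n} \<times> {0..n} = {}"
    by (auto simp: lower_tri_def)
  then have "card (lower_tri (n + 1)) = card (lower_tri n) + card ({n} \<times> {0..n})"
    unfolding lower_tri_Suc[OF step.hyps] by (intro card_Un_disjoint finite_lower_tri) auto
  then show ?case
    unfolding triangular_Suc using step by (simp add: card_cartesian_product)
qed

text \<open>The full rows above row \<open>i\<close> form the smaller triangle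
  \<open>lower_tri i\<close>; only the \<open>j\<close> cells to the left in row \<open>i\<close>
  remain to be counted.\<close>

lemma tri_index_eq:
  assumes "(i, j) \<in> lower_tri n"
  shows "tri_index n (i, j) = i * (i + 1) div 2 + j"
proof -
  have ij: "0 \<le> j" "j \<le> i" "i \<le> n - 1"
    using assms by (auto simp: lower_tri_def)
  have "{q \<in> lower_tri n. read_before q (i, j)} = lower_tri i \<union> {i} \<times> {0..<j}"
    using ij by (auto simp: lower_tri_def read_before_def)
  moreover have "lower_tri i \<inter> {i} \<times> {0..<j} = {}"
    by (auto simp: lower_tri_def)
  ultimately have "card {q \<in> lower_tri n. read_before q (i, j)} = card (lower_tri i) + card ({i} \<times> {0..<j})"
    by (simp add: card_Un_disjoint finite_lower_tri)
  then show ?thesis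
    using ij by (simp add: tri_index_def card_lower_tri card_cartesian_product)
qed

lemma g_triangular_add:
  assumes "0 \<le> j" "j \<le> i"
  shows "g (i * (i + 1) div 2 + j) = (i, j)"
proof -
  define l where "l = i * (i + 1) div 2 + j"
  \<comment> \<open>Doubling removes the \<open>div\<close>, exactly since
    \<open>i * (i + 1)\<close> is even, so the equation can pass to the reals.\<close>
  have "2 * l = i * (i + 1) + 2 * j"
    by (simp add: l_def)
  then have l: "2 * real_of_int l = of_int i * (of_int i + 1) + 2 * of_int j"
    by (metis of_int_add of_int_mult of_int_numeral of_int_1)
  have ij: "0 \<le> real_of_int j" "real_of_int j \<le> of_int i"
    using assms by auto
  \<comment> \<open>The square of \<open>i + 1 / 2\<close> is \<open>1 / 4 + i * (i + 1)\<close>, so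
    squaring leaves \<open>0 \<le> j\<close>.\<close>
  have "of_int i + 1 / 2 \<le> sqrt (1 / 4 + 2 * of_int l)"
    unfolding l using ij by (intro real_le_rsqrt) (simp add: power2_eq_square algebra_simps)
  \<comment> \<open>The square of \<open>i + 3 / 2\<close> exceeds the radicand by
    \<open>2 * (i + 1 - j)\<close>, positive as \<open>j \<le> i\<close>.\<close>
  moreover have "sqrt (1 / 4 + 2 * of_int l) < of_int i + 3 / 2"
    unfolding l using ij by (intro real_less_lsqrt) (simp_all add: power2_eq_square algebra_simps)
  ultimately have "\<lfloor>sqrt (1 / 4 + 2 * of_int l) - 1 / 2\<rfloor> = i"
    by (simp add: floor_eq_iff)
  then have "g l = (i, l - i * (i + 1) div 2)"
    by (simp add: g_def)
  then show ?thesis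
    by (simp add: l_def)
qed

corollary g_tri_index:
  assumes "p \<in> lower_tri n"
  shows "g (tri_index n p) = p"
proof -
  obtain i j where p: "p = (i, j)"
    by (cases p)
  with assms have "0 \<le> j" "j \<le> i"
    by (auto simp: lower_tri_def)
  then show ?thesis
    using assms unfolding p by (simp only: tri_index_eq g_triangular_add)
qed

lemma ex_triangular_add:
  assumes "n \<ge> 0" "0 \<le> l" "l < n * (n + 1) div 2"
  shows "\<exists>i j. (i, j) \<in> lower_tri n \<and> l = i * (i + 1) div 2 + j"
  using assms
proof (induction n rule: int_ge_induct)
  case base
  then show ?case
    by simp
next
  case (step n)
  show ?case
  proof (cases "l < n * (n + 1) div 2")
    case True
    then show ?thesis
      using step by (auto simp: lower_tri_Suc)
  next
    case False
    \<comment> \<open>Here \<open>l\<close> lies in the added row \<open>n\<close>, whose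
      \<open>n + 1\<close> numbers start at \<open>n * (n + 1) div 2\<close>; the offset from there
      is the column.\<close>
    then have "(n, l - n * (n + 1) div 2) \<in> lower_tri (n + 1)"
      using step.prems(2) unfolding triangular_Suc by (simp add: lower_tri_def)
    then show ?thesis
      by (intro exI[of _ n] exI[of _ "l - n * (n + 1) div 2"]) simp
  qed
qed

theorem mainTheorem1:
  fixes n x y l :: int
  assumes "n \<ge> 1"
    and "x \<in> {0..grid_width n - 1}" and "y \<in> {0..grid_width n - 1}"
    and "l = block_index n x y"
    and "l \<in> {0..n * (n + 1) div 2 - 1}"
  shows "(\<exists>!p. p \<in> lower_tri n \<and> tri_index n p = l) \<and> tri_position n l = g l"
proof -
  have "\<exists>i j. (i, j) \<in> lower_tri n \<and> l = i * (i + 1) div 2 + j"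
    using assms(1,5) by (intro ex_triangular_add) auto
  then obtain p where p: "p \<in> lower_tri n" "tri_index n p = l"
    by (metis tri_index_eq)
  have unique: "q = g l" if "q \<in> lower_tri n \<and> tri_index n q = l" for q
    using that g_tri_index by metis
  \<comment> \<open>The left inverse property forces \<open>p = g l\<close>, so \<open>g l\<close>
    inherits both facts about \<open>p\<close>.\<close>
  have g: "g l \<in> lower_tri n \<and> tri_index n (g l) = l"
    using p g_tri_index by metis
  have "tri_position n l = g l"
    unfolding tri_position_def using g unique by (rule the_equality)
  moreover have "\<exists>!p. p \<in> lower_tri n \<and> tri_index n p = l"
    using g unique by (rule ex1I)
  ultimately show ?thesis
    by blast
qed

end
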